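(* For $n,k\ge0$ let $p_{n,k}$ be the number of isomorphism classes of (2+2)-free posets with $n$ elements and exactly $k$ minimal elements. Then, as formal power series in $t,z$, $$\sum_{n,k\ge0}p_{n,k}t^nz^k=1+\sum_{n\ge0}\frac{zt}{(1-zt)^{n+1}}\prod_{i=1}^n\bigl(1-(1-t)^i\bigr).$$
   Context: Posets are finite and unlabeled (counted up to isomorphism); the empty poset counts as the unique poset with $0$ elements (so $p_{0,0}=1$). A poset is (2+2)-free if it has no induced subposet isomorphic to the disjoint union of two 2-element chains. An empty product equals $1$. *)

theory Defs
  imports "HOL-Analysis.Analysis" "HOL-Computational_Algebra.Formal_Power_Series"
begin

definition posets_on :: "nat \<Rightarrow> (nat \<times> nat) set set" where
  "posets_on n = {R. partial_order_on {0..<n} R}"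

definition incomparable :: "(nat \<times> nat) set \<Rightarrow> nat \<Rightarrow> nat \<Rightarrow> bool" where
  "incomparable R x y \<longleftrightarrow> (x, y) \<notin> R \<and> (y, x) \<notin> R"

definition two_two_free :: "(nat \<times> nat) set \<Rightarrow> bool" where
  "two_two_free R \<longleftrightarrow> \<not> (\<exists>a b c d.
      (a, b) \<in> R \<and> a \<noteq> b \<and> (c, d) \<in> R \<and> c \<noteq> d \<and>
      incomparable R a c \<and> incomparable R a d \<and>
      incomparable R b c \<and> incomparable R b d)"

definition minimal_elems :: "nat set \<Rightarrow> (nat \<times> nat) set \<Rightarrow> nat set" where
  "minimal_elems A R = {x \<in> A. \<not> (\<exists>y \<in> A. (y, x) \<in> R \<and> y \<noteq> x)}"

definition poset_iso :: "nat \<Rightarrow> ((nat \<times> nat) set \<times> (nat \<times> nat) set) set" where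
  "poset_iso n = {(R, S). \<exists>f. bij_betw f {0..<n} {0..<n} \<and>
      (\<forall>x\<in>{0..<n}. \<forall>y\<in>{0..<n}. (x, y) \<in> R \<longleftrightarrow> (f x, f y) \<in> S)}"

definition p_count :: "nat \<Rightarrow> nat \<Rightarrow> nat" where
  "p_count n k = card ({R \<in> posets_on n. two_two_free R \<and>
       card (minimal_elems {0..<n} R) = k} // poset_iso n)"

definition var_t :: "rat fps fps" where "var_t = fps_X"
definition var_z :: "rat fps fps" where "var_z = fps_const fps_X"

definition gen_fun :: "rat fps fps" where
  "gen_fun = Abs_fps (\<lambda>n. Abs_fps (\<lambda>k. of_nat (p_count n k)))"

definition rhs_term :: "nat \<Rightarrow> rat fps fps" where
  "rhs_term n = var_z * var_t * inverse ((1 - var_z * var_t) ^ (n + 1)) *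
       (\<Prod>i\<in>{1..n}. 1 - (1 - var_t) ^ i)"

end

theory Submission
  imports Defs "HOL-Combinatorics.Permutations"
begin

text \<open>In a (2+2)-free poset the strict down-sets form a chain. Recording for every element the index of
  its down-set and the last index of a down-set avoiding it turns the poset into an interval order, and
  counting elements with given indices \<open>(i, j)\<close> gives a bijection between isomorphism classes and
  upper triangular matrices over the naturals without zero rows or columns; the minimal elements are
  counted by the first row.

  Put \<open>p = 1 - t\<close>, \<open>q = 1 / p\<close>, \<open>w = 1 / (1 - z t)\<close>. Sieving over the zero rows, the matrices of size \<open>r + 1\<close>
  have generating function \<open>\<Sum>S. (-1)\<^bsup>|S|\<^esup> \<Prod>j\<le>r. (w q\<^bsup>b(j)\<^esup> - 1)\<close>, where \<open>S \<subseteq> {1..r}\<close> and \<open>b(j) = |{1..j} - S|\<close>.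
  With an additional factor \<open>\<phi> (b(r))\<close> the sum for \<open>r + 1\<close> equals the sum for \<open>r\<close> with \<open>\<phi>\<close> replaced by
  \<open>L \<phi> = (\<lambda>d. c (d + 1) \<phi> (d + 1) - c d \<phi> d)\<close>, where \<open>c d = w q\<^sup>d - 1\<close>. The function
  \<open>\<phi> d = (\<Sum>n. (w q\<^sup>d)\<^sup>n \<Prod>i=1..n. (1 - p\<^sup>i))\<close> satisfies \<open>\<phi> = 1 + L \<phi>\<close>, so the sum over \<open>r\<close> telescopes to
  \<open>c 0 \<phi> 0 = (w - 1) \<phi> 0\<close>, the right-hand side of the theorem. Everything is done with finite sums
  modulo \<open>t\<^bsup>N\<^esup>\<close>.\<close>

section \<open>The telescoping sieve\<close>

text \<open>The signed sum produced by inclusion-exclusion over the rows of an upper triangular matrix of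
  size \<open>r + 1\<close>: \<open>S\<close> is a set of rows forced to vanish, and a column of which \<open>b\<close> rows besides row \<open>0\<close> are
  allowed contributes \<open>c b\<close>. The factor \<open>\<phi>\<close> is what makes the sum obey a recursion in \<open>r\<close>.\<close>

definition row_sieve :: "(nat \<Rightarrow> 'a::comm_ring_1) \<Rightarrow> nat \<Rightarrow> (nat \<Rightarrow> 'a) \<Rightarrow> 'a" where
  "row_sieve c r \<phi> =
     (\<Sum>S\<in>Pow {1..r}. (-1) ^ card S * (\<Prod>j\<le>r. c (card ({1..j} - S))) * \<phi> (card ({1..r} - S)))"

lemma row_sieve_0: "row_sieve c 0 \<phi> = c 0 * \<phi> 0"
  by (simp add: row_sieve_def)

text \<open>Split the sets by whether they contain \<open>Suc r\<close>. With
  \<open>d = card ({1..r} - S)\<close>, leaving it out raises the last count to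
  \<open>Suc d\<close>, while putting it in keeps \<open>d\<close> and flips the sign.\<close>

lemma row_sieve_Suc:
  "row_sieve c (Suc r) \<phi> = row_sieve c r (\<lambda>d. c (Suc d) * \<phi> (Suc d) - c d * \<phi> d)"
proof -
  define T where "T S = (-1) ^ card S * (\<Prod>j\<le>Suc r. c (card ({1..j} - S))) * \<phi> (card ({1..Suc r} - S))" for S
  define U where "U S = (-1) ^ card S * (\<Prod>j\<le>r. c (card ({1..j} - S)))" for S
  have Suc_r: "{1..Suc r} = insert (Suc r) {1..r}" by auto
  have keep: "T S = U S * (c (Suc (card ({1..r} - S))) * \<phi> (Suc (card ({1..r} - S))))"
    if "S \<in> Pow {1..r}" for S
  proof -
    have "{1..Suc r} - S = insert (Suc r) ({1..r} - S)" using that by auto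
    then have "card ({1..Suc r} - S) = Suc (card ({1..r} - S))" by simp
    then show ?thesis by (simp add: T_def U_def)
  qed
  have drop: "T (insert (Suc r) S) = - (U S * (c (card ({1..r} - S)) * \<phi> (card ({1..r} - S))))"
    if "S \<in> Pow {1..r}" for S
  proof -
    have "Suc r \<notin> S" "finite S" using that finite_subset by auto
    then have "card (insert (Suc r) S) = Suc (card S)" by simp
    moreover have "{1..j} - insert (Suc r) S = {1..j} - S" if "j \<le> r" for j using that by auto
    moreover have "{1..Suc r} - insert (Suc r) S = {1..r} - S" by auto
    ultimately show ?thesis by (simp add: T_def U_def)
  qed
  have inj: "inj_on (insert (Suc r)) (Pow {1..r})"
    by (rule inj_onI) (metis PowD atLeastAtMost_iff insert_ident not_less_eq_eq order_refl subset_iff)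
  have "row_sieve c (Suc r) \<phi> = (\<Sum>S\<in>Pow {1..Suc r}. T S)"
    by (simp add: row_sieve_def T_def)
  also have "\<dots> = (\<Sum>S\<in>Pow {1..r}. T S) + (\<Sum>S\<in>insert (Suc r) ` Pow {1..r}. T S)"
    unfolding Suc_r Pow_insert by (rule sum.union_disjoint) auto
  also have "(\<Sum>S\<in>insert (Suc r) ` Pow {1..r}. T S) = (\<Sum>S\<in>Pow {1..r}. T (insert (Suc r) S))"
    using inj by (simp add: sum.reindex)
  also have "(\<Sum>S\<in>Pow {1..r}. T S) + \<dots> =
      row_sieve c r (\<lambda>d. c (Suc d) * \<phi> (Suc d) - c d * \<phi> d)"
    unfolding row_sieve_def sum.distrib [symmetric]
    by (intro sum.cong refl) (simp only: keep drop, simp add: U_def algebra_simps)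
  finally show ?thesis .
qed

lemma row_sieve_diff: "row_sieve c r (\<lambda>d. \<phi> d - \<psi> d) = row_sieve c r \<phi> - row_sieve c r \<psi>"
  by (simp add: row_sieve_def right_diff_distrib sum_subtractf)

lemma dvd_row_sieve: "(\<And>d. e dvd \<phi> d) \<Longrightarrow> e dvd row_sieve c r \<phi>"
  unfolding row_sieve_def by (intro dvd_sum dvd_mult)

lemma power_dvd_row_sieve:
  assumes "\<And>d. x dvd c d"
  shows "x ^ r dvd row_sieve c r \<phi>"
proof -
  have "x ^ Suc r dvd (\<Prod>j\<le>r. c (card ({1..j} - S)))" for S
    using prod_dvd_prod[of "{..r}" "\<lambda>_. x" "\<lambda>j. c (card ({1..j} - S))"] assms by simp
  then have "x ^ r dvd (\<Prod>j\<le>r. c (card ({1..j} - S)))" for S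
    by (rule power_le_dvd) simp
  then show ?thesis
    unfolding row_sieve_def by (intro dvd_sum dvd_mult2[OF dvd_mult])
qed

lemma dvd_mult_diff:
  fixes a b :: "'a::comm_ring_1"
  assumes "e dvd a - b" "e dvd c - d"
  shows "e dvd a * c - b * d"
proof -
  have "a * c - b * d = (a - b) * c + b * (c - d)" by (simp add: algebra_simps)
  then show ?thesis using assms by simp
qed

lemma dvd_prod_diff:
  fixes f g :: "'b \<Rightarrow> 'a::comm_ring_1"
  assumes "\<And>i. i \<in> A \<Longrightarrow> e dvd f i - g i"
  shows "e dvd prod f A - prod g A"
  using assms by (induction A rule: infinite_finite_induct) (auto intro: dvd_mult_diff)

lemma dvd_power_diff: "e dvd a - b \<Longrightarrow> e dvd a ^ n - (b :: 'a::comm_ring_1) ^ n"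
  by (induction n) (auto intro: dvd_mult_diff)

lemma row_sieve_cong:
  assumes "\<And>d. e dvd c d - c' d"
  shows "e dvd row_sieve c r \<phi> - row_sieve c' r \<phi>"
  unfolding row_sieve_def sum_subtractf [symmetric] 
  by (intro dvd_sum dvd_mult_diff dvd_prod_diff assms) auto

text \<open>Apply the linear map \<open>row_sieve c r\<close> to the equation for
  \<open>\<phi>\<close>: modulo \<open>x ^ N\<close> the summand for \<open>r\<close> is the
  difference of the sieves of \<open>\<phi>\<close> at \<open>r\<close> and \<open>Suc r\<close>.
  What telescoping leaves at \<open>N\<close> has a factor \<open>c\<close> for each column, hence
  is divisible by \<open>x ^ N\<close>.\<close>

lemma sum_row_sieve_telescope:
  fixes x :: "'a::comm_ring_1"
  assumes x: "\<And>d. x dvd c d"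
    and eq: "\<And>d. x ^ N dvd \<phi> d - 1 - (c (Suc d) * \<phi> (Suc d) - c d * \<phi> d)"
  shows "x ^ N dvd (\<Sum>r<N. row_sieve c r (\<lambda>_. 1)) - c 0 * \<phi> 0"
proof -
  have "x ^ N dvd row_sieve c r \<phi> - row_sieve c r (\<lambda>_. 1) - row_sieve c (Suc r) \<phi>" for r
    unfolding row_sieve_Suc row_sieve_diff [symmetric] by (rule dvd_row_sieve) (rule eq)
  then have "x ^ N dvd (\<Sum>r<N. row_sieve c r \<phi> - row_sieve c r (\<lambda>_. 1) - row_sieve c (Suc r) \<phi>)"
    by (intro dvd_sum)
  also have "\<dots> = (\<Sum>r<N. row_sieve c r \<phi> - row_sieve c (Suc r) \<phi>) - (\<Sum>r<N. row_sieve c r (\<lambda>_. 1))"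
    by (simp add: sum_subtractf)
  also have "\<dots> = c 0 * \<phi> 0 - row_sieve c N \<phi> - (\<Sum>r<N. row_sieve c r (\<lambda>_. 1))"
    using sum_lessThan_telescope'[of "\<lambda>r. row_sieve c r \<phi>" N] by (simp add: row_sieve_0)
  finally have *: "x ^ N dvd c 0 * \<phi> 0 - row_sieve c N \<phi> - (\<Sum>r<N. row_sieve c r (\<lambda>_. 1))" .
  have "x ^ N dvd - (c 0 * \<phi> 0 - row_sieve c N \<phi> - (\<Sum>r<N. row_sieve c r (\<lambda>_. 1))) - row_sieve c N \<phi>"
    by (intro dvd_diff) (use * power_dvd_row_sieve[OF x] in \<open>simp_all only: dvd_minus_iff\<close>)
  then show ?thesis by (simp add: algebra_simps)
qed

lemma power_dvd_prod_one_minus_power: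
  fixes x :: "'a::comm_ring_1"
  shows "x ^ n dvd (\<Prod>i=1..n. 1 - (1 - x) ^ i)"
proof -
  have "x dvd 1 - (1 - x) ^ i" for i
    using dvd_power_diff[of x 1 "1 - x" i] by simp
  then show ?thesis
    using prod_dvd_prod[of "{1..n}" "\<lambda>_. x" "\<lambda>i. 1 - (1 - x) ^ i"] by simp
qed

text \<open>With \<open>y = w q\<^sup>d\<close> this is the equation required by
  \<open>sum_row_sieve_telescope\<close>.\<close>

lemma geometric_prod_functional_eq:
  fixes x q y :: "'a::comm_ring_1" and N :: nat
  defines "\<phi> \<equiv> \<lambda>y. \<Sum>n<N. y ^ n * (\<Prod>i=1..n. 1 - (1 - x) ^ i)"
  assumes q: "(1 - x) * q = 1"
  shows "x ^ N dvd y * \<phi> y - 1 - (y * q - 1) * \<phi> (y * q)"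
proof -
  define P where "P n = (\<Prod>i=1..n. 1 - (1 - x) ^ i)" for n
  have P: "q ^ Suc n * (P n - P (Suc n)) = P n" for n
  proof -
    have "P (Suc n) = P n * (1 - (1 - x) ^ Suc n)"
      by (simp add: P_def mult.commute)
    then have "P n - P (Suc n) = (1 - x) ^ Suc n * P n"
      by (simp add: right_diff_distrib mult.commute del: power_Suc)
    then have "q ^ Suc n * (P n - P (Suc n)) = ((1 - x) * q) ^ Suc n * P n"
      by (simp only: power_mult_distrib mult_ac)
    then show ?thesis by (simp add: q)
  qed
  \<comment> \<open>With \<open>Y = y * q\<close>, the term \<open>(Y ^ Suc n - Y ^ n) * P n\<close>
    is split by inserting \<open>Y ^ Suc n * P (Suc n)\<close>: the second sum telescopes, and in
    the first the fact \<open>P\<close> trades \<open>Y ^ Suc n\<close> for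
    \<open>y ^ Suc n\<close>.\<close>
  have "(y * q - 1) * \<phi> (y * q) =
      (\<Sum>n<N. (y * q) ^ Suc n * (P n - P (Suc n))) +
      (\<Sum>n<N. (y * q) ^ Suc n * P (Suc n) - (y * q) ^ n * P n)"
    unfolding sum.distrib [symmetric] \<phi>_def P_def sum_distrib_left
    by (intro sum.cong refl) (simp add: algebra_simps)
  also have "(\<Sum>n<N. (y * q) ^ Suc n * P (Suc n) - (y * q) ^ n * P n) = (y * q) ^ N * P N - 1"
    by (subst sum_lessThan_telescope) (simp add: P_def)
  also have "(\<Sum>n<N. (y * q) ^ Suc n * (P n - P (Suc n))) = y * \<phi> y"
    unfolding \<phi>_def sum_distrib_left P_def [symmetric]
  proof (intro sum.cong refl)
    fix n
    have "(y * q) ^ Suc n * (P n - P (Suc n)) = y ^ Suc n * (q ^ Suc n * (P n - P (Suc n)))"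
      by (simp only: power_mult_distrib mult.assoc)
    then show "(y * q) ^ Suc n * (P n - P (Suc n)) = y * (y ^ n * P n)"
      by (simp only: P) (simp add: mult.assoc)
  qed
  finally have "y * \<phi> y - 1 - (y * q - 1) * \<phi> (y * q) = - ((y * q) ^ N * P N)"
    by simp
  moreover have "x ^ N dvd P N"
    unfolding P_def by (rule power_dvd_prod_one_minus_power)
  ultimately show ?thesis by simp
qed

lemma sum_row_sieve_geometric:
  fixes x q w :: "'a::comm_ring_1"
  assumes q: "(1 - x) * q = 1" and w: "x dvd w - 1"
  shows "x ^ N dvd (\<Sum>r<N. row_sieve (\<lambda>b. w * q ^ b - 1) r (\<lambda>_. 1)) -
    (w - 1) * (\<Sum>n<N. w ^ n * (\<Prod>i=1..n. 1 - (1 - x) ^ i))"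
proof -
  define \<phi> where "\<phi> y = (\<Sum>n<N. y ^ n * (\<Prod>i=1..n. 1 - (1 - x) ^ i))" for y
  \<comment> \<open>As \<open>q\<close> inverts \<open>1 - x\<close>, both \<open>q\<close> and
    \<open>w\<close> are 1 modulo \<open>x\<close>, so \<open>x\<close> divides every
    \<open>w * q ^ d - 1\<close>.\<close>
  have "q - 1 = q - (1 - x) * q" by (simp only: q)
  also have "\<dots> = x * q" by (simp add: left_diff_distrib)
  finally have "x dvd q - 1" by simp
  then have "x dvd w * q ^ d - 1" for d
    using dvd_mult_diff[OF w dvd_power_diff[of x q 1 d]] by simp
  moreover have "x ^ N dvd \<phi> (w * q ^ d) - 1 -
      ((w * q ^ Suc d - 1) * \<phi> (w * q ^ Suc d) - (w * q ^ d - 1) * \<phi> (w * q ^ d))" for d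
  proof -
    have "x ^ N dvd (w * q ^ d) * \<phi> (w * q ^ d) - 1 - (w * q ^ d * q - 1) * \<phi> (w * q ^ d * q)"
      unfolding \<phi>_def by (rule geometric_prod_functional_eq[OF q])
    then show ?thesis
      by (simp add: algebra_simps)
  qed
  ultimately have "x ^ N dvd (\<Sum>r<N. row_sieve (\<lambda>b. w * q ^ b - 1) r (\<lambda>_. 1)) -
      (w * q ^ 0 - 1) * \<phi> (w * q ^ 0)"
    by (rule sum_row_sieve_telescope)
  then show ?thesis by (simp add: \<phi>_def)
qed

section \<open>Interval orders and their matrices\<close>

text \<open>The matrix is encoded by the multiset of its positions, \<open>(i, j)\<close> occurring
  as often as the entry there says. Surjectivity of both projections onto \<open>{..<m}\<close>
  excludes zero rows and columns; \<open>m = 0\<close> leaves only the empty multiset.\<close>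

definition fishburn :: "nat \<Rightarrow> (nat \<times> nat) multiset \<Rightarrow> bool" where
  "fishburn m X \<longleftrightarrow> (\<forall>c\<in>#X. fst c \<le> snd c) \<and>
     fst ` set_mset X = {..<m} \<and> snd ` set_mset X = {..<m}"

definition interval_order :: "'a set \<Rightarrow> ('a \<Rightarrow> nat \<times> nat) \<Rightarrow> ('a \<times> 'a) set" where
  "interval_order A g = {(x, y) \<in> A \<times> A. x = y \<or> snd (g x) < fst (g y)}"

text \<open>The canonical interval representation of an interval order: the strict down-sets form a chain
  \<open>D\<^sub>0 \<subset> \<dots> \<subset> D\<^bsub>m-1\<^esub>\<close>; the pair of \<open>x\<close> is \<open>(i, j)\<close> where \<open>D\<^sub>i\<close> is the down-set of \<open>x\<close> and \<open>j\<close> is the last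
  index with \<open>x \<notin> D\<^sub>j\<close>.\<close>

definition down :: "('a \<times> 'a) set \<Rightarrow> 'a \<Rightarrow> 'a set" where
  "down R x = {y. (y, x) \<in> R \<and> y \<noteq> x}"

definition level_pair :: "'a set \<Rightarrow> ('a \<times> 'a) set \<Rightarrow> 'a \<Rightarrow> nat \<times> nat" where
  "level_pair A R x =
     (card {X \<in> down R ` A. X \<subset> down R x}, card {X \<in> down R ` A. x \<notin> X} - 1)"

lemma fishburn_image_mset_set:
  assumes "finite A"
  shows "fishburn m (image_mset g (mset_set A)) \<longleftrightarrow>
    (\<forall>x\<in>A. fst (g x) \<le> snd (g x)) \<and> (fst \<circ> g) ` A = {..<m} \<and> (snd \<circ> g) ` A = {..<m}"
  using assms by (simp add: fishburn_def image_comp)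

text \<open>Uniqueness of the representation. The down-set of \<open>y\<close> depends only on
  \<open>fst (g y)\<close>, and different indices below \<open>m\<close> give different down-sets,
  since each is a right endpoint. As each is also a left endpoint, the down-sets are exactly
  \<open>T 0\<close>, ..., \<open>T (m - 1)\<close>, and counting them returns
  \<open>g x\<close>.\<close>

lemma level_pair_interval_order:
  assumes A: "finite A" and g: "fishburn m (image_mset g (mset_set A))" and x: "x \<in> A"
  shows "level_pair A (interval_order A g) x = g x"
proof -
  let ?R = "interval_order A g"
  have le: "\<And>x. x \<in> A \<Longrightarrow> fst (g x) \<le> snd (g x)"
    and L: "(fst \<circ> g) ` A = {..<m}" and U: "(snd \<circ> g) ` A = {..<m}"
    using g A by (auto simp: fishburn_image_mset_set)
  define T where "T j = {z \<in> A. snd (g z) < j}" for j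
  have down: "down ?R y = T (fst (g y))" if "y \<in> A" for y
    using that le by (fastforce simp: down_def interval_order_def T_def)
  have T_less: "T i \<subset> T j" if "i < j" "i < m" for i j
  proof -
    have "i \<in> (snd \<circ> g) ` A" using \<open>i < m\<close> U by simp
    then obtain z where "z \<in> A" "snd (g z) = i" by auto
    then have "z \<in> T j" "z \<notin> T i" using that by (auto simp: T_def)
    moreover have "T i \<subseteq> T j" using that by (auto simp: T_def)
    ultimately show ?thesis by blast
  qed
  have T_psubset_iff: "T i \<subset> T j \<longleftrightarrow> i < j" if "i < m" "j < m" for i j
    using T_less[of i j] T_less[of j i] that by (cases i j rule: linorder_cases) auto
  have inj: "inj_on T {..<m}"
    by (rule inj_onI) (metis T_less lessThan_iff linorder_less_linear order_less_irrefl)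
  have range: "down ?R ` A = T ` {..<m}"
  proof -
    have "down ?R ` A = T ` ((fst \<circ> g) ` A)" using down by (auto simp: image_iff)
    then show ?thesis by (simp only: L)
  qed
  have m: "fst (g x) < m" "snd (g x) < m" using x L U by (auto simp: set_eq_iff image_iff)
  have "{i \<in> {..<m}. T i \<subset> T (fst (g x))} = {..<fst (g x)}"
    using T_psubset_iff[OF _ m(1)] less_trans[OF _ m(1)]
    unfolding set_eq_iff mem_Collect_eq lessThan_iff by blast
  then have "{X \<in> down ?R ` A. X \<subset> down ?R x} = T ` {..<fst (g x)}"
    unfolding range down[OF x] by blast
  moreover have "inj_on T {..<fst (g x)}" using m by (intro inj_on_subset[OF inj]) auto
  ultimately have 1: "card {X \<in> down ?R ` A. X \<subset> down ?R x} = fst (g x)"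
    by (simp add: card_image)
  \<comment> \<open>These are \<open>Suc (snd (g x))\<close> sets, because index 0 counts; hence the
    \<open>- 1\<close> in \<open>level_pair\<close>.\<close>
  have "{X \<in> down ?R ` A. x \<notin> X} = T ` {..snd (g x)}"
    unfolding range using m x by (auto simp: T_def)
  moreover have "inj_on T {..snd (g x)}" using m by (intro inj_on_subset[OF inj]) auto
  ultimately have 2: "card {X \<in> down ?R ` A. x \<notin> X} = Suc (snd (g x))"
    by (simp add: card_image)
  show ?thesis by (simp add: level_pair_def 1 2)
qed

text \<open>The rank increases strictly along the chain, hence is injective, and stays below
  \<open>card C\<close>; comparing cardinalities makes it onto.\<close>

lemma finite_chain_rank_image:
  assumes "finite C" and chain: "\<And>X Y. X \<in> C \<Longrightarrow> Y \<in> C \<Longrightarrow> X \<subseteq> Y \<or> Y \<subseteq> X"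
  shows "(\<lambda>X. card {Y \<in> C. Y \<subset> X}) ` C = {..<card C}"
proof -
  have less: "card {Y \<in> C. Y \<subset> X} < card {Y \<in> C. Y \<subset> X'}" if "X \<in> C" "X \<subset> X'" for X X'
    using that assms(1) by (intro psubset_card_mono) auto
  have "inj_on (\<lambda>X. card {Y \<in> C. Y \<subset> X}) C"
  proof (rule inj_onI)
    fix X X' assume X: "X \<in> C" "X' \<in> C" and eq: "card {Y \<in> C. Y \<subset> X} = card {Y \<in> C. Y \<subset> X'}"
    have "\<not> X \<subset> X'" "\<not> X' \<subset> X" using less[of X X'] less[of X' X] X eq by auto
    then show "X = X'" using chain[of X X'] X by auto
  qed
  then have "card ((\<lambda>X. card {Y \<in> C. Y \<subset> X}) ` C) = card {..<card C}"
    by (simp add: card_image)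
  moreover have "(\<lambda>X. card {Y \<in> C. Y \<subset> X}) ` C \<subseteq> {..<card C}"
    using assms(1) by (auto intro!: psubset_card_mono)
  ultimately show ?thesis by (intro card_subset_eq) auto
qed

text \<open>Otherwise some \<open>a\<close> strictly below \<open>x\<close> is not strictly below
  \<open>y\<close>, some \<open>c\<close> strictly below \<open>y\<close> is not strictly below
  \<open>x\<close>, and the two chains form an induced (2+2).\<close>

lemma two_two_free_down_chain:
  assumes R: "partial_order_on A R" and free: "two_two_free R"
  shows "down R x \<subseteq> down R y \<or> down R y \<subseteq> down R x"
proof (rule ccontr)
  assume "\<not> ?thesis"
  then obtain a c where a: "(a, x) \<in> R" "a \<noteq> x" "a \<notin> down R y"
    and c: "(c, y) \<in> R" "c \<noteq> y" "c \<notin> down R x"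
    by (auto simp: down_def)
  have tr: "\<And>u v w. (u, v) \<in> R \<Longrightarrow> (v, w) \<in> R \<Longrightarrow> (u, w) \<in> R"
    using R by (meson partial_order_onD(2) transD)
  have as: "\<And>u v. (u, v) \<in> R \<Longrightarrow> (v, u) \<in> R \<Longrightarrow> u = v"
    using R by (meson partial_order_onD(3) antisymD)
  \<comment> \<open>Here \<open>a = y\<close> is still possible; it is refuted later, since
    \<open>c\<close> would then lie strictly below \<open>x\<close>. The case \<open>c = x\<close>
    is symmetric.\<close>
  have ay: "(a, y) \<notin> R \<or> a = y" and cx: "(c, x) \<notin> R \<or> c = x"
    using a c by (auto simp: down_def)
  have "incomparable R a c" "incomparable R a y" "incomparable R x c" "incomparable R x y"
    unfolding incomparable_def using a(1,2) c(1,2) ay cx tr as by metis+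
  then show False using free a c unfolding two_two_free_def by blast
qed

text \<open>In the chain \<open>C\<close> the sets avoiding \<open>x\<close> form an initial segment
  with \<open>u x + 1\<close> members, those strictly inside \<open>down R y\<close> one with
  \<open>l y\<close> members. Thus \<open>x\<close> is in \<open>down R y\<close> iff the first
  segment lies within the second, that is iff \<open>u x < l y\<close>.\<close>

lemma two_two_free_imp_interval_order:
  fixes A :: "nat set"
  assumes R: "partial_order_on A R" and free: "two_two_free R" and A: "finite A"
  shows "\<exists>m. fishburn m (image_mset (level_pair A R) (mset_set A))"
    and "R = interval_order A (level_pair A R)"
proof -
  define C where "C = down R ` A"
  define l u where "l x = card {X \<in> C. X \<subset> down R x}" and "u x = card {X \<in> C. x \<notin> X} - 1" for x
  have lp: "level_pair A R x = (l x, u x)" for x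
    by (simp add: level_pair_def l_def u_def C_def)
  have finC: "finite C" using A by (simp add: C_def)
  have chain: "X \<subseteq> Y \<or> Y \<subseteq> X" if "X \<in> C" "Y \<in> C" for X Y
    using that two_two_free_down_chain[OF R free] unfolding C_def by blast
  have Suc_u: "card {X \<in> C. x \<notin> X} = Suc (u x)" if "x \<in> A" for x
  proof -
    \<comment> \<open>Since \<open>down R x\<close> itself avoids \<open>x\<close>, the count is
      positive and the subtraction in \<open>u\<close> is not truncated.\<close>
    have "down R x \<in> {X \<in> C. x \<notin> X}" using that by (auto simp: C_def down_def)
    then have "card {X \<in> C. x \<notin> X} \<noteq> 0" using finC by auto
    then show ?thesis by (simp add: u_def)
  qed
  have less_iff: "x \<in> down R y \<longleftrightarrow> u x < l y" if xy: "x \<in> A" "y \<in> A" for x y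
  proof
    assume "x \<in> down R y"
    then have "{X \<in> C. x \<notin> X} \<subseteq> {X \<in> C. X \<subset> down R y}"
      using chain[of "down R y"] xy by (auto simp: C_def)
    then have "Suc (u x) \<le> l y"
      unfolding l_def Suc_u[OF xy(1), symmetric] by (intro card_mono) (auto simp: finC)
    then show "u x < l y" by simp
  next
    assume "u x < l y"
    show "x \<in> down R y"
    proof (rule ccontr)
      assume "x \<notin> down R y"
      then have "insert (down R y) {X \<in> C. X \<subset> down R y} \<subseteq> {X \<in> C. x \<notin> X}"
        using xy by (auto simp: C_def)
      then have "card (insert (down R y) {X \<in> C. X \<subset> down R y}) \<le> Suc (u x)"
        unfolding Suc_u[OF xy(1), symmetric] by (intro card_mono) (auto simp: finC)
      then have "Suc (l y) \<le> Suc (u x)" by (simp add: l_def finC)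
      with \<open>u x < l y\<close> show False by simp
    qed
  qed
  have RA: "R \<subseteq> A \<times> A" and refl: "\<And>x. x \<in> A \<Longrightarrow> (x, x) \<in> R"
    using R by (auto simp: partial_order_on_def preorder_on_def refl_on_def)
  have down_eq: "down R y = {x \<in> A. u x < l y}" if "y \<in> A" for y
    using less_iff that RA by (auto simp: down_def)
  show "R = interval_order A (level_pair A R)"
  proof -
    have "(x, y) \<in> R \<longleftrightarrow> x = y \<or> u x < l y" if "x \<in> A" "y \<in> A" for x y
      using less_iff[OF that] refl that by (auto simp: down_def)
    then show ?thesis using RA by (auto simp: interval_order_def lp)
  qed
  have le: "l x \<le> u x" if "x \<in> A" for x
    using less_iff[OF that that] by (simp add: down_def)
  have L: "l ` A = {..<card C}"
  proof -
    have "l ` A = (\<lambda>X. card {Y \<in> C. Y \<subset> X}) ` C" by (auto simp: l_def C_def)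
    then show ?thesis using finite_chain_rank_image[OF finC chain] by simp
  qed
  have u_less: "u x < card C" if "x \<in> A" for x
    using Suc_u[OF that] card_mono[OF finC, of "{X \<in> C. x \<notin> X}"] by auto
  \<comment> \<open>The last index is attained because \<open>l y \<le> u y < card C\<close>. A
    smaller unattained \<open>j\<close> would make the down-sets of ranks \<open>j\<close> and
    \<open>Suc j\<close> equal, as \<open>u x < Suc j\<close> would then mean
    \<open>u x < j\<close>.\<close>
  have "j \<in> u ` A" if j: "j < card C" for j
  proof (rule ccontr)
    assume notin: "j \<notin> u ` A"
    from j L obtain y where y: "y \<in> A" "l y = j" by (metis imageE lessThan_iff)
    show False
    proof (cases "Suc j = card C")
      case True
      then have "u y = j" using le[OF y(1)] u_less[OF y(1)] y(2) by simp
      then show ?thesis using notin y by auto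
    next
      case False
      then have "Suc j \<in> l ` A" using j L by auto
      then obtain z where z: "z \<in> A" "l z = Suc j" by auto
      have "u x \<noteq> j" if "x \<in> A" for x using notin that by blast
      then have "down R z = down R y"
        unfolding down_eq[OF y(1)] down_eq[OF z(1)] y(2) z(2) by (auto simp: less_Suc_eq)
      then show ?thesis using y z by (simp add: l_def)
    qed
  qed
  then have "u ` A = {..<card C}" using u_less by auto
  then have "fishburn (card C) (image_mset (level_pair A R) (mset_set A))"
    using A le L by (simp add: fishburn_image_mset_set lp comp_def)
  then show "\<exists>m. fishburn m (image_mset (level_pair A R) (mset_set A))" by blast
qed

lemma partial_order_on_interval_order:
  assumes "\<And>x. x \<in> A \<Longrightarrow> fst (g x) \<le> snd (g x)"
  shows "partial_order_on A (interval_order A g)"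
proof -
  have "trans (interval_order A g)"
  proof (rule transI)
    fix x y z assume "(x, y) \<in> interval_order A g" "(y, z) \<in> interval_order A g"
    then show "(x, z) \<in> interval_order A g"
      using assms[of y] by (auto simp: interval_order_def)
  qed
  moreover have "antisym (interval_order A g)"
  proof (rule antisymI)
    fix x y assume "(x, y) \<in> interval_order A g" "(y, x) \<in> interval_order A g"
    then show "x = y"
      using assms[of x] assms[of y] by (auto simp: interval_order_def)
  qed
  ultimately show ?thesis
    by (auto simp: partial_order_on_def preorder_on_def refl_on_def interval_order_def)
qed

text \<open>For \<open>a < b\<close> and \<open>c < d\<close> with neither \<open>a < d\<close> nor
  \<open>c < b\<close>, the endpoints would satisfy \<open>fst (g d) \<le> snd (g a) < fst (g b)
  \<le> snd (g c) < fst (g d)\<close>.\<close>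

lemma two_two_free_interval_order: "two_two_free (interval_order A g)"
  unfolding two_two_free_def incomparable_def
proof safe
  fix a b c d
  assume "(a, b) \<in> interval_order A g" "a \<noteq> b" "(c, d) \<in> interval_order A g" "c \<noteq> d"
    and "(a, d) \<notin> interval_order A g" "(c, b) \<notin> interval_order A g"
  then show False by (auto simp: interval_order_def)
qed

text \<open>Index 0 is the right endpoint of some element, which then lies below every element with
  a positive left endpoint.\<close>

lemma minimal_elems_interval_order:
  assumes A: "finite A" and g: "fishburn m (image_mset g (mset_set A))"
  shows "minimal_elems A (interval_order A g) = {x \<in> A. fst (g x) = 0}"
proof -
  have le: "\<And>x. x \<in> A \<Longrightarrow> fst (g x) \<le> snd (g x)"
    and L: "(fst \<circ> g) ` A = {..<m}" and U: "(snd \<circ> g) ` A = {..<m}"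
    using g A by (auto simp: fishburn_image_mset_set)
  have "(\<exists>y\<in>A. (y, x) \<in> interval_order A g \<and> y \<noteq> x) \<longleftrightarrow> fst (g x) \<noteq> 0" if x: "x \<in> A" for x
  proof
    assume "fst (g x) \<noteq> 0"
    moreover have "fst (g x) < m" using x L by (auto simp: set_eq_iff image_iff)
    ultimately have "0 \<in> (snd \<circ> g) ` A" using U by auto
    then obtain y where "y \<in> A" "snd (g y) = 0" by auto
    then show "\<exists>y\<in>A. (y, x) \<in> interval_order A g \<and> y \<noteq> x"
      using \<open>fst (g x) \<noteq> 0\<close> x le[OF x] by (auto simp: interval_order_def intro!: bexI[of _ y])
  qed (auto simp: interval_order_def)
  then show ?thesis unfolding minimal_elems_def by blast
qed

lemma size_filter_image_mset_set:
  "finite A \<Longrightarrow> size (filter_mset P (image_mset g (mset_set A))) = card {x \<in> A. P (g x)}"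
  by (simp add: filter_mset_image_mset filter_mset_mset_set)

section \<open>Isomorphism classes as multisets of index pairs\<close>

lemma equiv_poset_iso: "equiv UNIV (poset_iso n)"
proof (rule equivI)
  show "refl (poset_iso n)"
    by (auto simp: refl_on_def poset_iso_def intro!: exI[of _ id])
  show "sym (poset_iso n)"
  proof (rule symI)
    fix R S assume "(R, S) \<in> poset_iso n"
    then obtain f where f: "bij_betw f {0..<n} {0..<n}"
      and iso: "\<And>x y. x \<in> {0..<n} \<Longrightarrow> y \<in> {0..<n} \<Longrightarrow> (x, y) \<in> R \<longleftrightarrow> (f x, f y) \<in> S"
      by (auto simp: poset_iso_def)
    let ?h = "inv_into {0..<n} f"
    have "(x, y) \<in> S \<longleftrightarrow> (?h x, ?h y) \<in> R" if "x \<in> {0..<n}" "y \<in> {0..<n}" for x y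
      using that iso[of "?h x" "?h y"] bij_betw_inv_into_right[OF f] bij_betwE[OF bij_betw_inv_into[OF f]]
      by simp
    then show "(S, R) \<in> poset_iso n"
      using bij_betw_inv_into[OF f] by (auto simp: poset_iso_def)
  qed
  show "trans (poset_iso n)"
  proof (rule transI)
    fix R S T assume "(R, S) \<in> poset_iso n" "(S, T) \<in> poset_iso n"
    then obtain f g where f: "bij_betw f {0..<n} {0..<n}" and g: "bij_betw g {0..<n} {0..<n}"
      and iso: "\<And>x y. x \<in> {0..<n} \<Longrightarrow> y \<in> {0..<n} \<Longrightarrow> (x, y) \<in> R \<longleftrightarrow> (f x, f y) \<in> S"
        "\<And>x y. x \<in> {0..<n} \<Longrightarrow> y \<in> {0..<n} \<Longrightarrow> (x, y) \<in> S \<longleftrightarrow> (g x, g y) \<in> T"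
      by (auto simp: poset_iso_def)
    have "(x, y) \<in> R \<longleftrightarrow> ((g \<circ> f) x, (g \<circ> f) y) \<in> T" if "x \<in> {0..<n}" "y \<in> {0..<n}" for x y
      using that iso(1)[OF that] iso(2)[of "f x" "f y"] f by (auto dest: bij_betwE)
    then show "(R, T) \<in> poset_iso n"
      unfolding poset_iso_def using bij_betw_trans[OF f g] by blast
  qed
qed simp

lemma interval_order_comp_bij:
  assumes f: "bij_betw f A A" and R: "R \<subseteq> A \<times> A"
    and iso: "\<And>x y. x \<in> A \<Longrightarrow> y \<in> A \<Longrightarrow> (x, y) \<in> R \<longleftrightarrow> (f x, f y) \<in> interval_order A g"
  shows "R = interval_order A (g \<circ> f)"
proof -
  have "(x, y) \<in> R \<longleftrightarrow> x = y \<or> snd (g (f x)) < fst (g (f y))" if "x \<in> A" "y \<in> A" for x y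
    using iso[OF that] that f by (auto simp: interval_order_def bij_betw_def inj_on_eq_iff)
  then show ?thesis using R by (auto simp: interval_order_def)
qed

lemma image_mset_set_comp_bij:
  assumes "bij_betw f A A"
  shows "image_mset (g \<circ> f) (mset_set A) = image_mset g (mset_set A)"
proof -
  have "image_mset f (mset_set A) = mset_set A"
    using assms by (simp add: bij_betw_def image_mset_mset_set)
  then show ?thesis by (metis image_mset.compositionality)
qed

text \<open>An isomorphism pulls the representation of \<open>S\<close> back to one of
  \<open>R\<close>, by uniqueness the canonical one, so the multisets agree. Conversely, equal
  multisets are matched by a permutation, which is an isomorphism because the pairs determine both
  orders.\<close>

lemma poset_iso_iff:
  assumes R: "R \<in> posets_on n" "two_two_free R" and S: "S \<in> posets_on n" "two_two_free S"
  shows "(R, S) \<in> poset_iso n \<longleftrightarrow>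
    image_mset (level_pair {0..<n} R) (mset_set {0..<n}) =
    image_mset (level_pair {0..<n} S) (mset_set {0..<n})"
proof -
  let ?A = "{0..<n}"
  let ?g = "level_pair ?A R" and ?h = "level_pair ?A S"
  have Rg: "R = interval_order ?A ?g" and Sh: "S = interval_order ?A ?h"
    using R S two_two_free_imp_interval_order(2)[of ?A] by (simp_all add: posets_on_def)
  obtain m where h: "fishburn m (image_mset ?h (mset_set ?A))"
    using S two_two_free_imp_interval_order(1)[of ?A S] by (auto simp: posets_on_def)
  show ?thesis
  proof
    assume "(R, S) \<in> poset_iso n"
    then obtain f where f: "bij_betw f ?A ?A"
      and iso: "\<And>x y. x \<in> ?A \<Longrightarrow> y \<in> ?A \<Longrightarrow> (x, y) \<in> R \<longleftrightarrow> (f x, f y) \<in> S"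
      by (auto simp: poset_iso_def)
    have "R \<subseteq> ?A \<times> ?A" using R by (auto simp: posets_on_def partial_order_on_def preorder_on_def)
    then have R_eq: "R = interval_order ?A (?h \<circ> f)"
      using f iso Sh by (intro interval_order_comp_bij) auto
    have "level_pair ?A R x = (?h \<circ> f) x" if "x \<in> ?A" for x
      unfolding R_eq using that h f
      by (intro level_pair_interval_order[where m = m]) (simp_all only: image_mset_set_comp_bij finite_atLeastLessThan)
    then have "image_mset ?g (mset_set ?A) = image_mset (?h \<circ> f) (mset_set ?A)"
      by (intro image_mset_cong) simp
    then show "image_mset ?g (mset_set ?A) = image_mset ?h (mset_set ?A)"
      using f by (simp only: image_mset_set_comp_bij)
  next
    assume "image_mset ?g (mset_set ?A) = image_mset ?h (mset_set ?A)"
    then obtain p where p: "p permutes ?A" and gh: "\<forall>x\<in>?A. ?g x = ?h (p x)"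
      by (rule image_mset_eq_implies_permutes[rotated]) auto
    have bij: "bij_betw p ?A ?A" by (rule permutes_imp_bij[OF p])
    have "(x, y) \<in> R \<longleftrightarrow> (p x, p y) \<in> S" if "x \<in> ?A" "y \<in> ?A" for x y
      using that gh bij permutes_in_image[OF p] permutes_inj[OF p]
      by (subst Rg, subst Sh) (simp add: interval_order_def inj_eq)
    then show "(R, S) \<in> poset_iso n"
      using bij by (auto simp: poset_iso_def)
  qed
qed

text \<open>Both images are in bijection with the classes of the common kernel of \<open>f\<close>
  and \<open>g\<close>. This lets multisets be counted in place of isomorphism classes.\<close>

lemma card_image_eq_if_same_fibres:
  assumes "\<And>x y. x \<in> A \<Longrightarrow> y \<in> A \<Longrightarrow> f x = f y \<longleftrightarrow> g x = g y"
  shows "card (f ` A) = card (g ` A)"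
proof -
  have "bij_betw (f \<circ> inv_into A g) (g ` A) (f ` A)"
    by (rule bij_betwI'; (force simp: assms inv_into_into f_inv_into_f))
  then show ?thesis by (simp add: bij_betw_same_card)
qed

lemma p_count_eq_card_fishburn:
  "p_count n k = card {X. (\<exists>m. fishburn m X) \<and> size X = n \<and> size {#c \<in># X. fst c = 0#} = k}"
    (is "_ = card ?\<X>")
proof -
  let ?A = "{0..<n}"
  let ?P = "{R \<in> posets_on n. two_two_free R \<and> card (minimal_elems ?A R) = k}"
  define profile where "profile R = image_mset (level_pair ?A R) (mset_set ?A)" for R
  have "profile ` ?P = ?\<X>"
  proof (intro equalityI subsetI)
    fix X assume "X \<in> profile ` ?P"
    then obtain R where R: "partial_order_on ?A R" "two_two_free R"
        "card (minimal_elems ?A R) = k" and X: "X = profile R"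
      by (auto simp: posets_on_def)
    obtain m where m: "fishburn m X"
      using two_two_free_imp_interval_order(1)[OF R(1,2)] by (auto simp: X profile_def)
    have "minimal_elems ?A R = {x \<in> ?A. fst (level_pair ?A R x) = 0}"
      using minimal_elems_interval_order[of ?A m "level_pair ?A R"] m
        two_two_free_imp_interval_order(2)[OF R(1,2)] by (simp add: X profile_def)
    then have "size {#c \<in># X. fst c = 0#} = k"
      using R(3) by (simp only: X profile_def size_filter_image_mset_set finite_atLeastLessThan)
    moreover have "size X = n" by (simp add: X profile_def)
    ultimately show "X \<in> ?\<X>" using m by blast
  next
    fix X assume "X \<in> ?\<X>"
    then obtain m where m: "fishburn m X" and X: "size X = n" "size {#c \<in># X. fst c = 0#} = k"
      by blast
    \<comment> \<open>Any enumeration of \<open>X\<close> attaches its pairs to the labels below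
      \<open>n\<close>, and the resulting interval order has profile \<open>X\<close>.\<close>
    obtain xs where xs: "mset xs = X" by (metis ex_mset)
    define g where "g = (!) xs"
    have len: "length xs = n" using X xs by auto
    have g: "image_mset g (mset_set ?A) = X"
      unfolding g_def xs [symmetric] len [symmetric] mset_set_upto_eq_mset_upto
      by (metis atLeast0LessThan map_nth mset_map mset_set_upto_eq_mset_upto)
    have fg: "fishburn m (image_mset g (mset_set ?A))" by (simp only: g m)
    let ?R = "interval_order ?A g"
    have "?R \<in> posets_on n"
      using fg by (auto simp: posets_on_def fishburn_image_mset_set intro!: partial_order_on_interval_order)
    moreover have "two_two_free ?R" by (rule two_two_free_interval_order)
    moreover have "card (minimal_elems ?A ?R) = k"
      using minimal_elems_interval_order[OF _ fg]
        X(2)[unfolded g [symmetric] size_filter_image_mset_set[OF finite_atLeastLessThan]] by simp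
    moreover have "profile ?R = X"
    proof -
      have "profile ?R = image_mset g (mset_set ?A)"
        unfolding profile_def using level_pair_interval_order[OF _ fg] by (intro image_mset_cong) simp
      then show ?thesis by (simp only: g)
    qed
    ultimately show "X \<in> profile ` ?P" by blast
  qed
  moreover have "?P // poset_iso n = (\<lambda>R. poset_iso n `` {R}) ` ?P"
    by (auto simp: quotient_def)
  moreover have "card ((\<lambda>R. poset_iso n `` {R}) ` ?P) = card (profile ` ?P)"
    by (rule card_image_eq_if_same_fibres)
      (simp add: eq_equiv_class_iff[OF equiv_poset_iso] poset_iso_iff profile_def)
  ultimately show ?thesis by (simp add: p_count_def)
qed

section \<open>Counting the matrices\<close>

text \<open>The entry in row \<open>i\<close> and column \<open>j\<close> is \<open>f j i\<close>, so that a matrix is a family of columns.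
  The bound \<open>N\<close> on the entries keeps all sums finite; it is harmless modulo \<open>t\<^bsup>N\<^esup>\<close>.\<close>

definition nonzero_columns :: "nat \<Rightarrow> nat \<Rightarrow> (nat \<Rightarrow> nat) set" where
  "nonzero_columns N j = {g \<in> {..j} \<rightarrow>\<^sub>E {..N}. \<exists>i\<le>j. g i \<noteq> 0}"

definition fishburn_matrices :: "nat \<Rightarrow> nat \<Rightarrow> (nat \<Rightarrow> nat \<Rightarrow> nat) set" where
  "fishburn_matrices N r =
     {f \<in> Pi\<^sub>E {..r} (nonzero_columns N). \<forall>i\<in>{1..r}. \<exists>j\<in>{i..r}. f j i \<noteq> 0}"

lemma finite_nonzero_columns [simp]: "finite (nonzero_columns N j)"
proof -
  have "finite ({..j} \<rightarrow>\<^sub>E {..N})" by (intro finite_PiE) auto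
  then show ?thesis by (simp add: nonzero_columns_def)
qed

lemma finite_fishburn_matrices [simp]: "finite (fishburn_matrices N r)"
proof -
  have "finite (Pi\<^sub>E {..r} (nonzero_columns N))" by (intro finite_PiE) auto
  then show ?thesis by (simp add: fishburn_matrices_def)
qed

text \<open>A row outside \<open>S\<close> contributes a geometric sum, a row in \<open>S\<close>
  only the entry 0; row 0 is never in \<open>S\<close> and has its own weight. The final
  \<open>- 1\<close> removes the zero column.\<close>

lemma sum_columns_avoiding_rows:
  fixes v :: "nat \<Rightarrow> 'a::comm_ring_1"
  assumes v: "\<And>i. i \<noteq> 0 \<Longrightarrow> v i = x" and S: "0 \<notin> S"
  shows "(\<Sum>g | g \<in> nonzero_columns N j \<and> (\<forall>i\<in>S. i \<le> j \<longrightarrow> g i = 0). \<Prod>i\<le>j. v i ^ g i) =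
    (\<Sum>a\<le>N. v 0 ^ a) * (\<Sum>a\<le>N. x ^ a) ^ card ({1..j} - S) - 1"
proof -
  define D where "D i = (if i \<in> S then {0} else {..N})" for i
  define z where "z = restrict (\<lambda>_. 0 :: nat) {..j}"
  have fin: "finite (Pi\<^sub>E {..j} D)" by (intro finite_PiE) (auto simp: D_def)
  have z: "z \<in> Pi\<^sub>E {..j} D" by (auto simp: z_def D_def)
  have "{g. g \<in> nonzero_columns N j \<and> (\<forall>i\<in>S. i \<le> j \<longrightarrow> g i = 0)} = Pi\<^sub>E {..j} D - {z}"
  proof (intro equalityI subsetI)
    fix g assume "g \<in> {g. g \<in> nonzero_columns N j \<and> (\<forall>i\<in>S. i \<le> j \<longrightarrow> g i = 0)}"
    then show "g \<in> Pi\<^sub>E {..j} D - {z}"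
      by (auto simp: nonzero_columns_def D_def z_def PiE_iff)
  next
    fix g assume g: "g \<in> Pi\<^sub>E {..j} D - {z}"
    have "\<exists>i\<le>j. g i \<noteq> 0"
    proof (rule ccontr)
      assume "\<not> (\<exists>i\<le>j. g i \<noteq> 0)"
      then have "g = z" using g by (intro PiE_ext[of g "{..j}" D z]) (auto simp: z_def D_def)
      then show False using g by simp
    qed
    moreover have "g i \<in> D i" if "i \<le> j" for i using g that by (auto simp: PiE_iff)
    then have "g i \<le> N" "i \<in> S \<Longrightarrow> g i = 0" if "i \<le> j" for i
      using that by (force simp: D_def split: if_splits)+
    moreover have "g \<in> extensional {..j}" using g by (simp add: PiE_iff)
    ultimately show "g \<in> {g. g \<in> nonzero_columns N j \<and> (\<forall>i\<in>S. i \<le> j \<longrightarrow> g i = 0)}"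
      by (simp add: nonzero_columns_def PiE_iff)
  qed
  then have "(\<Sum>g | g \<in> nonzero_columns N j \<and> (\<forall>i\<in>S. i \<le> j \<longrightarrow> g i = 0). \<Prod>i\<le>j. v i ^ g i) =
      (\<Sum>g\<in>Pi\<^sub>E {..j} D. \<Prod>i\<le>j. v i ^ g i) - (\<Prod>i\<le>j. v i ^ z i)"
    using fin z by (simp add: sum_diff1)
  also have "(\<Prod>i\<le>j. v i ^ z i) = 1" by (simp add: z_def)
  also have "(\<Sum>g\<in>Pi\<^sub>E {..j} D. \<Prod>i\<le>j. v i ^ g i) = (\<Prod>i\<le>j. \<Sum>a\<in>D i. v i ^ a)"
    by (intro prod_sum_PiE [symmetric]) (auto simp: D_def)
  also have "\<dots> = (\<Sum>a\<in>D 0. v 0 ^ a) * (\<Prod>i\<in>{1..j}. \<Sum>a\<in>D i. v i ^ a)"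
  proof -
    have "{..j} = insert 0 {1..j}" by auto
    then show ?thesis by simp
  qed
  also have "(\<Sum>a\<in>D 0. v 0 ^ a) = (\<Sum>a\<le>N. v 0 ^ a)" using S by (simp add: D_def)
  also have "(\<Prod>i\<in>{1..j}. \<Sum>a\<in>D i. v i ^ a) = (\<Prod>i\<in>{1..j} - S. \<Sum>a\<le>N. x ^ a)"
    by (rule prod.mono_neutral_cong_right) (auto simp: D_def v)
  finally show ?thesis by simp
qed

text \<open>Inclusion-exclusion over the set \<open>S\<close> of rows that are required to vanish. Row \<open>0\<close> needs no
  sieving, since the column \<open>0\<close> of an upper triangular matrix has no other entry.\<close>

lemma sum_fishburn_matrices:
  fixes v :: "nat \<Rightarrow> 'a::comm_ring_1"
  assumes v: "\<And>i. i \<noteq> 0 \<Longrightarrow> v i = x"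
  shows "(\<Sum>f\<in>fishburn_matrices N r. \<Prod>j\<le>r. \<Prod>i\<le>j. v i ^ f j i) =
    row_sieve (\<lambda>b. (\<Sum>a\<le>N. v 0 ^ a) * (\<Sum>a\<le>N. x ^ a) ^ b - 1) r (\<lambda>_. 1)"
proof -
  define F where "F = Pi\<^sub>E {..r} (nonzero_columns N)"
  define Z where "Z f i \<longleftrightarrow> (\<forall>j\<in>{i..r}. f j i = 0)" for f :: "nat \<Rightarrow> nat \<Rightarrow> nat" and i
  define W where "W f = (\<Prod>j\<le>r. \<Prod>i\<le>j. v i ^ f j i)" for f :: "nat \<Rightarrow> nat \<Rightarrow> nat"
  have finF: "finite F" unfolding F_def by (intro finite_PiE) auto
  have sieve: "of_bool (f \<in> fishburn_matrices N r) * W f =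
      (\<Sum>S\<in>Pow {1..r}. (-1) ^ card S * (of_bool (\<forall>i\<in>S. Z f i) * W f))" if "f \<in> F" for f
  proof -
    have "of_bool (f \<in> fishburn_matrices N r) = (\<Prod>i\<in>{1..r}. 1 - of_bool (Z f i) :: 'a)"
    proof (cases "\<exists>i\<in>{1..r}. Z f i")
      case True
      then have "(\<Prod>i\<in>{1..r}. 1 - of_bool (Z f i) :: 'a) = 0"
        by (intro prod_zero) auto
      then show ?thesis using True by (auto simp: fishburn_matrices_def Z_def)
    next
      case False
      then have "(\<Prod>i\<in>{1..r}. 1 - of_bool (Z f i) :: 'a) = 1"
        by (intro prod.neutral) auto
      then show ?thesis using False that by (auto simp: fishburn_matrices_def F_def Z_def)
    qed
    also have "\<dots> = (\<Sum>S\<in>Pow {1..r}. (-1) ^ card S * (\<Prod>i\<in>S. of_bool (Z f i)))"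
      by (subst prod_diff_conv_sum) simp_all
    also have "\<dots> = (\<Sum>S\<in>Pow {1..r}. (-1) ^ card S * of_bool (\<forall>i\<in>S. Z f i))"
    proof (intro sum.cong refl)
      fix S assume "S \<in> Pow {1..r}"
      then have "finite S" using finite_subset by auto
      then have "(\<Prod>i\<in>S. of_bool (Z f i)) = (of_bool (\<forall>i\<in>S. Z f i) :: 'a)"
        by (induction S rule: finite_induct) auto
      then show "(-1) ^ card S * (\<Prod>i\<in>S. of_bool (Z f i)) = (-1) ^ card S * (of_bool (\<forall>i\<in>S. Z f i) :: 'a)"
        by simp
    qed
    finally show ?thesis by (simp only: sum_distrib_right mult.assoc)
  qed
  have inner: "(\<Sum>f\<in>F. of_bool (\<forall>i\<in>S. Z f i) * W f) =
      (\<Prod>j\<le>r. (\<Sum>a\<le>N. v 0 ^ a) * (\<Sum>a\<le>N. x ^ a) ^ card ({1..j} - S) - 1)"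
    if S: "S \<in> Pow {1..r}" for S
  proof -
    define E where "E j = {g. g \<in> nonzero_columns N j \<and> (\<forall>i\<in>S. i \<le> j \<longrightarrow> g i = 0)}" for j
    have "(\<Sum>f\<in>F. of_bool (\<forall>i\<in>S. Z f i) * W f) = (\<Sum>f\<in>{f \<in> F. \<forall>i\<in>S. Z f i}. W f)"
      using finF by (intro sum.mono_neutral_cong_right) auto
    \<comment> \<open>Vanishing of the rows in \<open>S\<close> is a condition on each column
      separately, so the remaining matrices again form a product set and the sum factors over the
      columns.\<close>
    also have "{f \<in> F. \<forall>i\<in>S. Z f i} = Pi\<^sub>E {..r} E"
      by (auto simp: F_def E_def Z_def PiE_iff extensional_def)
    also have "(\<Sum>f\<in>Pi\<^sub>E {..r} E. W f) = (\<Prod>j\<le>r. \<Sum>g\<in>E j. \<Prod>i\<le>j. v i ^ g i)"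
      unfolding W_def by (rule prod_sum_PiE [symmetric]) (auto simp: E_def)
    also have "\<dots> = (\<Prod>j\<le>r. (\<Sum>a\<le>N. v 0 ^ a) * (\<Sum>a\<le>N. x ^ a) ^ card ({1..j} - S) - 1)"
      unfolding E_def using S by (intro prod.cong refl sum_columns_avoiding_rows v) auto
    finally show ?thesis .
  qed
  have "(\<Sum>f\<in>fishburn_matrices N r. W f) = (\<Sum>f\<in>F. of_bool (f \<in> fishburn_matrices N r) * W f)"
    using finF by (intro sum.mono_neutral_cong_left) (auto simp: F_def fishburn_matrices_def)
  also have "\<dots> = (\<Sum>f\<in>F. \<Sum>S\<in>Pow {1..r}. (-1) ^ card S * (of_bool (\<forall>i\<in>S. Z f i) * W f))"
    by (intro sum.cong refl sieve)
  also have "\<dots> = (\<Sum>S\<in>Pow {1..r}. (-1) ^ card S * (\<Sum>f\<in>F. of_bool (\<forall>i\<in>S. Z f i) * W f))"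
    by (subst sum.swap) (simp add: sum_distrib_left)
  also have "\<dots> = row_sieve (\<lambda>b. (\<Sum>a\<le>N. v 0 ^ a) * (\<Sum>a\<le>N. x ^ a) ^ b - 1) r (\<lambda>_. 1)"
    unfolding row_sieve_def by (intro sum.cong refl) (simp only: inner mult_1_right)
  finally show ?thesis by (simp add: W_def)
qed

section \<open>Multisets of positions as matrices\<close>

text \<open>This is the form that matches \<open>fishburn_matrices\<close>. Row 0 can be left out of
  the row condition because column 0 can only be met at \<open>(0, 0)\<close>.\<close>

lemma fishburn_Suc_iff:
  "fishburn (Suc r) X \<longleftrightarrow> (\<forall>c\<in>#X. fst c \<le> snd c \<and> snd c \<le> r) \<and>
     (\<forall>j\<le>r. \<exists>i\<le>j. (i, j) \<in># X) \<and> (\<forall>i\<in>{1..r}. \<exists>j\<in>{i..r}. (i, j) \<in># X)"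
    (is "?l \<longleftrightarrow> ?r")
proof
  assume l: ?l
  then have le: "\<And>c. c \<in># X \<Longrightarrow> fst c \<le> snd c \<and> snd c \<le> r"
    by (auto simp: fishburn_def set_eq_iff image_iff less_Suc_eq_le)
  have "\<exists>i\<le>j. (i, j) \<in># X" if "j \<le> r" for j
  proof -
    have "j \<in> snd ` set_mset X" using l that by (simp add: fishburn_def)
    then show ?thesis using le by fastforce
  qed
  moreover have "\<exists>j\<in>{i..r}. (i, j) \<in># X" if "i \<in> {1..r}" for i
  proof -
    have "i \<in> fst ` set_mset X" using l that by (simp add: fishburn_def)
    then show ?thesis using le by fastforce
  qed
  ultimately show ?r using le by blast
next
  assume r: ?r
  then have le: "\<And>c. c \<in># X \<Longrightarrow> fst c \<le> snd c \<and> snd c \<le> r" by blast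
  have "i \<in> fst ` set_mset X" if "i \<le> r" for i
  proof (cases "i = 0")
    case True
    with r have "(0, 0) \<in># X" by fastforce
    with True show ?thesis by force
  next
    case False
    with r that obtain j where "(i, j) \<in># X" by (metis One_nat_def Suc_leI atLeastAtMost_iff bot_nat_0.not_eq_extremum)
    then show ?thesis by force
  qed
  moreover have "j \<in> snd ` set_mset X" if "j \<le> r" for j
    using r that by force
  ultimately have "fst ` set_mset X = {..<Suc r}" "snd ` set_mset X = {..<Suc r}"
    using le by (fastforce simp: less_Suc_eq_le)+
  then show ?l using le by (simp add: fishburn_def)
qed

lemma size_upper_triangular:
  fixes X :: "(nat \<times> nat) multiset"
  assumes "\<forall>c\<in>#X. fst c \<le> snd c \<and> snd c \<le> r"
  shows "size X = (\<Sum>j\<le>r. \<Sum>i\<le>j. count X (i, j))"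
proof -
  have "size X = sum (count X) (set_mset X)" by (simp add: size_multiset_overloaded_eq)
  also have "\<dots> = sum (count X) (prod.swap ` (SIGMA j:{..r}. {..j}))"
  proof (rule sum.mono_neutral_left)
    show "set_mset X \<subseteq> prod.swap ` (SIGMA j:{..r}. {..j})"
      using assms by (force simp: image_iff)
  qed (auto simp: not_in_iff)
  also have "\<dots> = (\<Sum>(j, i)\<in>(SIGMA j:{..r}. {..j}). count X (i, j))"
    by (subst sum.reindex) (auto simp: case_prod_beta prod.swap_def)
  also have "\<dots> = (\<Sum>j\<le>r. \<Sum>i\<le>j. count X (i, j))"
    by (subst sum.Sigma) auto
  finally show ?thesis .
qed

lemma size_first_row:
  fixes X :: "(nat \<times> nat) multiset"
  assumes "\<forall>c\<in>#X. fst c \<le> snd c \<and> snd c \<le> r"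
  shows "size {#c \<in># X. fst c = 0#} = (\<Sum>j\<le>r. count X (0, j))"
proof -
  have "size {#c \<in># X. fst c = 0#} = (\<Sum>j\<le>r. \<Sum>i\<le>j. if i = 0 then count X (i, j) else 0)"
    using assms by (subst size_upper_triangular[where r = r]) (auto intro!: sum.cong)
  moreover have "(\<Sum>i\<le>j. if i = 0 then count X (i, j) else 0) = count X (0, j)" for j
    using sum.delta[of "{..j}" 0 "\<lambda>i. count X (i, j)"] by simp
  ultimately show ?thesis by simp
qed

text \<open>Entries are multiplicities, and \<open>n \<le> N\<close> makes them fit the bound in
  \<open>nonzero_columns\<close>. The inverse extends a matrix by 0 outside the triangle, which
  gives finite support.\<close>

lemma bij_betw_fishburn_matrices:
  assumes "n \<le> N"
  shows "bij_betw (\<lambda>X. \<lambda>j\<in>{..r}. \<lambda>i\<in>{..j}. count X (i, j))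
    {X. fishburn (Suc r) X \<and> size X = n \<and> size {#c \<in># X. fst c = 0#} = k}
    {f \<in> fishburn_matrices N r. (\<Sum>j\<le>r. \<Sum>i\<le>j. f j i) = n \<and> (\<Sum>j\<le>r. f j 0) = k}"
    (is "bij_betw ?M ?\<X> ?\<F>")
proof (rule bij_betw_imageI)
  show "inj_on ?M ?\<X>"
  proof (rule inj_onI)
    fix X Y assume X: "X \<in> ?\<X>" and Y: "Y \<in> ?\<X>" and eq: "?M X = ?M Y"
    have supp: "c \<notin># X" "c \<notin># Y" if "\<not> (fst c \<le> snd c \<and> snd c \<le> r)" for c
      using X Y that by (auto simp: fishburn_Suc_iff)
    show "X = Y"
    proof (rule multiset_eqI)
      fix c
      show "count X c = count Y c"
      proof (cases "fst c \<le> snd c \<and> snd c \<le> r")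
        case True
        then show ?thesis using fun_cong[OF fun_cong[OF eq, of "snd c"], of "fst c"] by simp
      next
        case False
        then show ?thesis using supp[OF False] by (simp add: not_in_iff)
      qed
    qed
  qed
  show "?M ` ?\<X> = ?\<F>"
  proof (intro equalityI subsetI)
    fix f assume "f \<in> ?M ` ?\<X>"
    then obtain X where X: "fishburn (Suc r) X" "size X = n" "size {#c \<in># X. fst c = 0#} = k"
      and f: "f = ?M X" by blast
    have "count X c \<le> N" for c
      using count_le_size[of X c] X(2) assms by simp
    then have "f \<in> fishburn_matrices N r"
      using X(1) unfolding fishburn_matrices_def nonzero_columns_def f fishburn_Suc_iff
      by (auto simp: PiE_iff count_eq_zero_iff)
    moreover have "(\<Sum>j\<le>r. \<Sum>i\<le>j. f j i) = n"
      using X size_upper_triangular[of X r] by (simp add: f fishburn_Suc_iff)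
    moreover have "(\<Sum>j\<le>r. f j 0) = k"
      using X size_first_row[of X r] by (simp add: f fishburn_Suc_iff)
    ultimately show "f \<in> ?\<F>" by blast
  next
    fix f assume f: "f \<in> ?\<F>"
    define h where "h c = (if fst c \<le> snd c \<and> snd c \<le> r then f (snd c) (fst c) else 0)" for c
    define X where "X = Abs_multiset h"
    have "{c. 0 < h c} \<subseteq> {..r} \<times> {..r}" by (auto simp: h_def split: if_splits)
    then have "finite {c. 0 < h c}" by (rule finite_subset) simp
    then have count: "count X c = h c" for c by (simp add: X_def)
    have inX: "c \<in># X \<longleftrightarrow> h c \<noteq> 0" for c
      by (simp add: count [symmetric])
    have MX: "?M X = f"
    proof (intro ext)
      fix j i
      show "?M X j i = f j i"
        using f by (auto simp: count h_def fishburn_matrices_def nonzero_columns_def PiE_iff extensional_def restrict_def)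
    qed
    have fish: "fishburn (Suc r) X"
      using f unfolding fishburn_Suc_iff
      by (auto simp: inX h_def fishburn_matrices_def nonzero_columns_def PiE_iff split: if_splits)
    then have supp: "\<forall>c\<in>#X. fst c \<le> snd c \<and> snd c \<le> r" by (simp add: fishburn_Suc_iff)
    have "size X = n" "size {#c \<in># X. fst c = 0#} = k"
      using f by (simp_all add: size_upper_triangular[OF supp] size_first_row[OF supp] count h_def)
    then show "f \<in> ?M ` ?\<X>" using fish MX by blast
  qed
qed

text \<open>The matrix size \<open>m\<close> is the number of distinct left indices, so the multiset
  determines it and it is at most \<open>n\<close>. The size 0 is the empty poset and gives the
  first term; size \<open>Suc r\<close> gives the summand for \<open>r\<close>.\<close>

lemma p_count_eq_sum_fishburn_matrices:
  assumes "n \<le> N"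
  shows "p_count n k = of_bool (n = 0 \<and> k = 0) +
    (\<Sum>r<N. card {f \<in> fishburn_matrices N r. (\<Sum>j\<le>r. \<Sum>i\<le>j. f j i) = n \<and> (\<Sum>j\<le>r. f j 0) = k})"
proof -
  define Y where "Y m = {X. fishburn m X \<and> size X = n \<and> size {#c \<in># X. fst c = 0#} = k}" for m
  define F where "F r = {f \<in> fishburn_matrices N r. (\<Sum>j\<le>r. \<Sum>i\<le>j. f j i) = n \<and> (\<Sum>j\<le>r. f j 0) = k}" for r
  have bij: "bij_betw (\<lambda>X. \<lambda>j\<in>{..r}. \<lambda>i\<in>{..j}. count X (i, j)) (Y (Suc r)) (F r)" for r
    unfolding Y_def F_def by (rule bij_betw_fishburn_matrices[OF assms])
  have Y0: "Y 0 = (if n = 0 \<and> k = 0 then {{#}} else {})"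
    by (auto simp: Y_def fishburn_def)
  have fin: "finite (Y m)" for m
  proof (cases m)
    case (Suc r)
    have "finite (F r)" by (simp add: F_def)
    then show ?thesis using bij_betw_finite[OF bij[of r]] Suc by simp
  qed (simp add: Y0)
  have m_eq: "m = card (fst ` set_mset X)" if "X \<in> Y m" for X m
    using that by (simp add: Y_def fishburn_def)
  have m_less: "m \<in> {..<Suc N}" if "X \<in> Y m" for X m
  proof -
    have "card (fst ` set_mset X) \<le> card (set_mset X)" by (simp add: card_image_le)
    also have "\<dots> = (\<Sum>c\<in>set_mset X. 1)" by simp
    also have "\<dots> \<le> (\<Sum>c\<in>set_mset X. count X c)" by (rule sum_mono) simp
    also have "\<dots> = size X" by (simp add: size_multiset_overloaded_eq)
    finally show ?thesis using m_eq[OF that] that assms by (simp add: Y_def)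
  qed
  have "{X. (\<exists>m. fishburn m X) \<and> size X = n \<and> size {#c \<in># X. fst c = 0#} = k} = (\<Union>m<Suc N. Y m)"
    using m_less unfolding Y_def by blast
  then have "p_count n k = card (\<Union>m<Suc N. Y m)" by (simp add: p_count_eq_card_fishburn)
  also have "\<dots> = (\<Sum>m<Suc N. card (Y m))"
  proof (rule card_UN_disjoint)
    have "m = m'" if "X \<in> Y m" "X \<in> Y m'" for X m m'
      using m_eq[OF that(1)] m_eq[OF that(2)] by simp
    then show "\<forall>m\<in>{..<Suc N}. \<forall>m'\<in>{..<Suc N}. m \<noteq> m' \<longrightarrow> Y m \<inter> Y m' = {}" by blast
  qed (use fin in auto)
  also have "\<dots> = card (Y 0) + (\<Sum>r<N. card (Y (Suc r)))"
    by (rule sum.lessThan_Suc_shift)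
  also have "(\<Sum>r<N. card (Y (Suc r))) = (\<Sum>r<N. card (F r))"
    using bij_betw_same_card[OF bij] by simp
  finally show ?thesis by (simp add: Y0 F_def)
qed

section \<open>Power series in \<open>t\<close> and \<open>z\<close>\<close>

text \<open>Every element is marked by \<open>var_t\<close>; those in row 0, the minimal ones, also
  by \<open>var_z\<close>.\<close>

definition entry_weight :: "nat \<Rightarrow> rat fps fps" where
  "entry_weight i = (if i = 0 then var_z * var_t else var_t)"

lemma prod_entry_weight:
  "(\<Prod>j\<le>r. \<Prod>i\<le>j. entry_weight i ^ f j i) =
     var_z ^ (\<Sum>j\<le>r. f j 0) * var_t ^ (\<Sum>j\<le>r. \<Sum>i\<le>j. f j i)"
proof -
  have "(\<Prod>i\<le>j. entry_weight i ^ f j i) = var_z ^ f j 0 * var_t ^ (\<Sum>i\<le>j. f j i)" for j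
  proof -
    have "(\<Prod>i\<le>j. entry_weight i ^ f j i) = (\<Prod>i\<le>j. (if i = 0 then var_z ^ f j i else 1) * var_t ^ f j i)"
      by (intro prod.cong) (auto simp: entry_weight_def power_mult_distrib)
    then show ?thesis by (simp add: prod.distrib power_sum)
  qed
  then show ?thesis by (simp add: prod.distrib power_sum)
qed

lemma fps_nth_var_z_var_t: "fps_nth (fps_nth (var_z ^ a * var_t ^ b) n) k = of_bool (n = b \<and> k = a)"
  by (auto simp: var_z_def var_t_def fps_const_power fps_X_power_iff)

lemma gen_fun_nth_eq:
  assumes "n \<le> N"
  shows "fps_nth gen_fun n =
    fps_nth (1 + (\<Sum>r<N. \<Sum>f\<in>fishburn_matrices N r. \<Prod>j\<le>r. \<Prod>i\<le>j. entry_weight i ^ f j i)) n"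
proof (rule fps_ext)
  fix k
  have card_eq: "(of_nat (card {f \<in> fishburn_matrices N r. (\<Sum>j\<le>r. \<Sum>i\<le>j. f j i) = n \<and> (\<Sum>j\<le>r. f j 0) = k}) :: rat) =
      (\<Sum>f\<in>fishburn_matrices N r. of_bool (n = (\<Sum>j\<le>r. \<Sum>i\<le>j. f j i) \<and> k = (\<Sum>j\<le>r. f j 0)))" for r
    by (subst sum_of_bool_eq) (auto intro!: arg_cong[where f = card])
  have "fps_nth (fps_nth gen_fun n) k = of_nat (p_count n k)" by (simp add: gen_fun_def)
  also have "\<dots> = of_bool (n = 0 \<and> k = 0) +
     (\<Sum>r<N. \<Sum>f\<in>fishburn_matrices N r. of_bool (n = (\<Sum>j\<le>r. \<Sum>i\<le>j. f j i) \<and> k = (\<Sum>j\<le>r. f j 0)))"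
    unfolding p_count_eq_sum_fishburn_matrices[OF assms]
    by (simp only: of_nat_add of_nat_sum of_nat_of_bool card_eq)
  also have "\<dots> = fps_nth (fps_nth
      (1 + (\<Sum>r<N. \<Sum>f\<in>fishburn_matrices N r. \<Prod>j\<le>r. \<Prod>i\<le>j. entry_weight i ^ f j i)) n) k"
    by (simp add: fps_sum_nth prod_entry_weight fps_nth_var_z_var_t)
  finally show "fps_nth (fps_nth gen_fun n) k = \<dots>" .
qed

text \<open>The coefficients in \<open>rat fps\<close> do not form a field, so invertibility rests
  on the constant coefficient being 1.\<close>

lemma mult_inverse_fps_fps:
  fixes f :: "rat fps fps"
  assumes "fps_nth f 0 = 1"
  shows "f * inverse f = 1"
proof -
  have "f * fps_right_inverse f 1 = 1" by (rule fps_right_inverse) (simp add: assms)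
  moreover have "inverse f = fps_right_inverse f 1"
    unfolding fps_inverse_def[of f] by (simp add: assms)
  ultimately show ?thesis by simp
qed

lemma inverse_power_fps_fps:
  fixes f :: "rat fps fps"
  assumes "fps_nth f 0 = 1"
  shows "inverse (f ^ n) = inverse f ^ n"
proof -
  have "fps_nth (f ^ n) 0 = 1" by (simp add: assms fps_power_zeroth_eq_one)
  then have 1: "f ^ n * inverse (f ^ n) = 1" by (rule mult_inverse_fps_fps)
  have 2: "f ^ n * inverse f ^ n = 1"
    by (simp add: mult_inverse_fps_fps[OF assms] flip: power_mult_distrib)
  have "inverse (f ^ n) = inverse (f ^ n) * (f ^ n * inverse f ^ n)" by (simp only: 2 mult_1_right)
  also have "\<dots> = (f ^ n * inverse (f ^ n)) * inverse f ^ n" by (simp only: mult_ac)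
  finally show ?thesis by (simp only: 1 mult_1_left)
qed

lemma geometric_sum_truncation:
  fixes x :: "'a::comm_ring_1"
  assumes "(1 - x) * y = 1"
  shows "x ^ Suc N dvd (\<Sum>a\<le>N. x ^ a) - y"
proof -
  have "(\<Sum>a\<le>N. x ^ a) = y * ((1 - x) * (\<Sum>a\<le>N. x ^ a))"
    using assms by (metis mult.assoc mult.commute mult_1_left)
  also have "\<dots> = y - y * x ^ Suc N" by (simp only: sum_gp_basic right_diff_distrib mult_1_right)
  finally show ?thesis by simp
qed

lemma fps_X_power_dvd_imp_nth_eq_0:
  fixes f :: "'a::comm_ring_1 fps"
  assumes "fps_X ^ N dvd f" "n < N"
  shows "fps_nth f n = 0"
  using assms by (auto simp: dvd_def fps_X_power_mult_nth)

theorem theorem8: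
  shows "rhs_term sums (gen_fun - 1)"
proof -
  define w where "w = inverse (1 - var_z * var_t)"
  define q where "q = inverse (1 - var_t)"
  have nth0: "fps_nth (1 - var_z * var_t) 0 = 1" "fps_nth (1 - var_t) 0 = 1"
    by (simp_all add: var_t_def)
  have w: "(1 - var_z * var_t) * w = 1" and q: "(1 - var_t) * q = 1"
    unfolding w_def q_def by (intro mult_inverse_fps_fps nth0)+
  have "w - 1 = w - (1 - var_z * var_t) * w" by (simp only: w)
  also have "\<dots> = var_z * var_t * w" by (simp add: left_diff_distrib)
  finally have w1: "w - 1 = var_z * var_t * w" .
  \<comment> \<open>One of the \<open>n + 1\<close> factors \<open>w\<close> in
    \<open>rhs_term n\<close> combines with \<open>var_z * var_t\<close> to
    \<open>w - 1\<close>.\<close>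
  have rhs: "(\<Sum>n<N. rhs_term n) = (w - 1) * (\<Sum>n<N. w ^ n * (\<Prod>i=1..n. 1 - (1 - var_t) ^ i))" for N
    unfolding sum_distrib_left
  proof (intro sum.cong refl)
    fix n
    show "rhs_term n = (w - 1) * (w ^ n * (\<Prod>i=1..n. 1 - (1 - var_t) ^ i))"
      unfolding rhs_term_def inverse_power_fps_fps[OF nth0(1)] w_def [symmetric] w1 by (simp add: mult_ac)
  qed
  have dvd: "var_t ^ N dvd (\<Sum>r<N. \<Sum>f\<in>fishburn_matrices N r. \<Prod>j\<le>r. \<Prod>i\<le>j. entry_weight i ^ f j i) -
      (\<Sum>n<N. rhs_term n)" for N
  proof -
    \<comment> \<open>Entries bounded by \<open>N\<close> produce truncated geometric sums; modulo
      \<open>var_t ^ N\<close> these agree with the inverses \<open>w\<close> and \<open>q\<close>,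
      and the sieve respects the congruence.\<close>
    define w' where "w' = (\<Sum>a\<le>N. (var_z * var_t) ^ a)"
    define q' where "q' = (\<Sum>a\<le>N. var_t ^ a)"
    have "var_t ^ N dvd (var_z * var_t) ^ Suc N" by (simp add: power_mult_distrib)
    then have w': "var_t ^ N dvd w' - w"
      using geometric_sum_truncation[OF w] unfolding w'_def by (rule dvd_trans)
    have "var_t ^ N dvd var_t ^ Suc N" by simp
    then have q': "var_t ^ N dvd q' - q"
      using geometric_sum_truncation[OF q] unfolding q'_def by (rule dvd_trans)
    have "(\<Sum>f\<in>fishburn_matrices N r. \<Prod>j\<le>r. \<Prod>i\<le>j. entry_weight i ^ f j i) =
        row_sieve (\<lambda>b. w' * q' ^ b - 1) r (\<lambda>_. 1)" for r
      using sum_fishburn_matrices[where v = entry_weight and x = var_t and N = N and r = r]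
      by (simp add: entry_weight_def w'_def q'_def)
    moreover have "var_t ^ N dvd row_sieve (\<lambda>b. w' * q' ^ b - 1) r (\<lambda>_. 1) -
        row_sieve (\<lambda>b. w * q ^ b - 1) r (\<lambda>_. 1)" for r
      using dvd_mult_diff[OF w' dvd_power_diff[OF q']] by (intro row_sieve_cong) simp
    ultimately have "var_t ^ N dvd
        (\<Sum>r<N. \<Sum>f\<in>fishburn_matrices N r. \<Prod>j\<le>r. \<Prod>i\<le>j. entry_weight i ^ f j i) -
        (\<Sum>r<N. row_sieve (\<lambda>b. w * q ^ b - 1) r (\<lambda>_. 1))"
      unfolding sum_subtractf [symmetric] by (intro dvd_sum) simp
    moreover have "var_t ^ N dvd (\<Sum>r<N. row_sieve (\<lambda>b. w * q ^ b - 1) r (\<lambda>_. 1)) - (\<Sum>n<N. rhs_term n)"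
      unfolding rhs by (rule sum_row_sieve_geometric[OF q]) (simp add: w1)
    ultimately show ?thesis
      by (metis (no_types, lifting) diff_add_cancel add_diff_eq dvd_add)
  qed
  \<comment> \<open>The congruence modulo \<open>var_t ^ N\<close> fixes the coefficient of index
    \<open>n\<close> once \<open>N > n\<close>. So each coefficient of the partial sums is
    eventually constant, which is convergence of formal power series.\<close>
  have "fps_nth (\<Sum>r<N. rhs_term r) n = fps_nth (gen_fun - 1) n" if "n < N" for n N
    using fps_X_power_dvd_imp_nth_eq_0[OF dvd[of N, unfolded var_t_def] that]
      gen_fun_nth_eq[of n N] that by simp
  then have "\<forall>\<^sub>F N in sequentially. fps_nth (\<Sum>r<N. rhs_term r) n = fps_nth (gen_fun - 1) n" for n
    by (intro eventually_sequentiallyI[of "Suc n"]) simp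
  then show ?thesis unfolding sums_def by (rule tendsto_fpsI)
qed

end
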